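(* Let $n\ge 1$, let $\mathbf{A}\in\mathbb{C}^{n\times n}$, and let $\mathbf{B}=(\mathbf{A}+\mathbf{A}^\dagger)/2$ and $\mathbf{C}=(\mathbf{A}-\mathbf{A}^\dagger)/2$ be its Hermitian and skew-Hermitian parts. If $z\in\mathbb{C}$ is a fremdervalue of $\mathbf{A}$, then the following three conditions hold. (i) $\min\lambda(\mathbf{B})\le\mathrm{Re}(z)\le\max\lambda(\mathbf{B})$. (ii) $\min\mathrm{Im}(\lambda(\mathbf{C}))\le\mathrm{Im}(z)\le\max\mathrm{Im}(\lambda(\mathbf{C}))$. (iii) Equality cannot be attained in both (i) and (ii): it is not the case that both $\mathrm{Re}(z)\in\{\min\lambda(\mathbf{B}),\max\lambda(\mathbf{B})\}$ and $\mathrm{Im}(z)\in\{\min\mathrm{Im}(\lambda(\mathbf{C})),\max\mathrm{Im}(\lambda(\mathbf{C}))\}$. (For instance, if $\mathrm{Re}(z)=\min\lambda(\mathbf{B})$, then $\min\mathrm{Im}(\lambda(\mathbf{C}))<\mathrm{Im}(z)<\max\mathrm{Im}(\lambda(\mathbf{C}))$.)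
   Context: $\langle\cdot,\cdot\rangle$ is the usual inner product on $\mathbb{C}^n$, $\mathbf{M}^\dagger$ is the conjugate transpose of $\mathbf{M}$, $\lambda(\mathbf{M})$ is the spectrum of $\mathbf{M}$, and $\mathrm{Im}(\lambda(\mathbf{M}))$ is the set of imaginary parts of the elements of $\lambda(\mathbf{M})$. For $\mathbf{M}\in\mathbb{C}^{n\times n}$, a fremdervector of $\mathbf{M}$ is a vector $x\in\mathbb{C}^n$ with $\langle x,\mathbf{M}x\rangle=0$; it is nontrivial if $x\notin\ker(\mathbf{M})\cup\ker(\mathbf{M}^\dagger)$. A scalar $z\in\mathbb{C}$ is a fremdervalue of $\mathbf{A}$ if $z\mathbf{I}-\mathbf{A}$ has a nontrivial fremdervector. *)

theory Defs
  imports "Jordan_Normal_Form.Spectral_Radius" "Jordan_Normal_Form.Matrix_Kernel"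
begin

(* The definitions are meant for square matrices. mat_adjoint is the conjugate transpose;
   the inner product \<bullet>c is conjugate-linear in its second argument, but whether it vanishes
   does not depend on which of the two arguments is conjugated. *)

definition fremdervector :: "complex mat \<Rightarrow> complex vec \<Rightarrow> bool" where
  "fremdervector M x \<longleftrightarrow> x \<in> carrier_vec (dim_row M) \<and> x \<bullet>c (M *\<^sub>v x) = 0"

definition nontrivial_fremdervector :: "complex mat \<Rightarrow> complex vec \<Rightarrow> bool" where
  "nontrivial_fremdervector M x \<longleftrightarrow>
     fremdervector M x \<and> x \<notin> mat_kernel M \<union> mat_kernel (mat_adjoint M)"

definition fremdervalue :: "complex mat \<Rightarrow> complex \<Rightarrow> bool" where
  "fremdervalue A z \<longleftrightarrow>
     (\<exists>x. nontrivial_fremdervector (z \<cdot>\<^sub>m 1\<^sub>m (dim_row A) - A) x)"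

definition hermitian_part :: "complex mat \<Rightarrow> complex mat" where
  "hermitian_part A = (1 / 2) \<cdot>\<^sub>m (A + mat_adjoint A)"

definition skew_hermitian_part :: "complex mat \<Rightarrow> complex mat" where
  "skew_hermitian_part A = (1 / 2) \<cdot>\<^sub>m (A - mat_adjoint A)"

(* Eigenvalues have type complex, which carries no linear order. A Hermitian matrix has a real
   spectrum, so for Hermitian M the set below is the spectrum itself, regarded as a set of
   reals. *)

definition re_spectrum :: "complex mat \<Rightarrow> real set" where
  "re_spectrum M = Re ` spectrum M"

definition im_spectrum :: "complex mat \<Rightarrow> real set" where
  "im_spectrum M = Im ` spectrum M"

end

theory Submission
  imports Defs
begin

text \<open>
  Fix a vector \<open>x\<close> witnessing that \<open>z\<close> is a fremdervalue of \<open>A\<close>. The orthogonality of \<open>x\<close> and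
  \<open>(z I - A) x\<close> says that \<open>\<langle>A x, x\<rangle> = z \<langle>x, x\<rangle>\<close>: the scalar \<open>z\<close> is the Rayleigh quotient of \<open>A\<close>
  at \<open>x\<close>. Passing to the Hermitian and skew-Hermitian parts, \<open>Re z\<close> and \<open>\<i> Im z\<close> are the Rayleigh
  quotients of \<open>B\<close> and \<open>C\<close> at the same \<open>x\<close>. A Rayleigh quotient of a Hermitian matrix lies
  between its extreme eigenvalues, and reaches one of them only at an eigenvector; applied to
  \<open>B\<close>, \<open>- B\<close>, \<open>- \<i> C\<close> and \<open>\<i> C\<close>, this gives both chains of inequalities. If one bound of each
  chain were attained, then \<open>x\<close> would be an eigenvector of \<open>B\<close> and of \<open>C\<close>, hence of
  \<open>A = B + C\<close>, necessarily for the eigenvalue \<open>z\<close>; so \<open>x\<close> would lie in the kernel of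
  \<open>z I - A\<close>, contrary to nontriviality.

  The Rayleigh bound (\<open>lowest_eigenvalue\<close>) is obtained neither from a diagonalization nor from
  compactness of the sphere. Let \<open>m\<close> be the largest number for which \<open>G = H - m I\<close> is positive
  semidefinite. For such \<open>G\<close> one has \<open>\<langle>G x, G x\<rangle> \<le> c \<langle>G x, x\<rangle>\<close> with a constant \<open>c\<close>
  (\<open>positive_semidefinite_image_bound\<close>). This single inequality does two things: if \<open>G\<close> were
  invertible, it would bound \<open>\<langle>G x, x\<rangle>\<close> below by a positive multiple of \<open>\<langle>x, x\<rangle>\<close>, so \<open>m\<close> could
  be enlarged; and it forces \<open>G x = 0\<close> as soon as \<open>\<langle>G x, x\<rangle> = 0\<close>, which is the equality case.
\<close>

section \<open>The adjoint and the Hermitian inner product\<close>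

lemma mat_adjoint_carrier [simp]:
  "A \<in> carrier_mat nr nc \<Longrightarrow> mat_adjoint A \<in> carrier_mat nc nr"
  unfolding mat_adjoint_def by auto

lemma dim_mat_adjoint [simp]:
  "dim_row (mat_adjoint A) = dim_col A" "dim_col (mat_adjoint A) = dim_row A"
  unfolding mat_adjoint_def by auto

lemma index_mat_adjoint:
  fixes A :: "complex mat"
  assumes "A \<in> carrier_mat nr nc" "i < nc" "j < nr"
  shows "mat_adjoint A $$ (i, j) = cnj (A $$ (j, i))"
  using assms unfolding mat_adjoint_def by (auto simp: mat_of_rows_index)

lemma cscalar_prod_sum:
  fixes v w :: "complex vec"
  assumes "w \<in> carrier_vec n"
  shows "v \<bullet>c w = (\<Sum>i<n. v $ i * cnj (w $ i))"
  using assms by (auto simp: scalar_prod_def lessThan_atLeast0 intro!: sum.cong)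

lemma index_mult_mat_vec_sum:
  fixes A :: "complex mat"
  assumes "A \<in> carrier_mat nr nc" "v \<in> carrier_vec nc" "i < nr"
  shows "(A *\<^sub>v v) $ i = (\<Sum>j<nc. A $$ (i, j) * v $ j)"
  using assms by (auto simp: scalar_prod_def lessThan_atLeast0 intro!: sum.cong)

lemma smult_mat_mult_mat_vec:
  fixes A :: "complex mat"
  assumes "A \<in> carrier_mat nr nc" "v \<in> carrier_vec nc"
  shows "(a \<cdot>\<^sub>m A) *\<^sub>v v = a \<cdot>\<^sub>v (A *\<^sub>v v)"
  using assms by (intro eq_vecI) (auto simp: scalar_prod_def sum_distrib_left mult.assoc)

lemma cscalar_prod_adjoint:
  fixes A :: "complex mat"
  assumes A: "A \<in> carrier_mat nr nc" and x: "x \<in> carrier_vec nc" and y: "y \<in> carrier_vec nr"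
  shows "(A *\<^sub>v x) \<bullet>c y = x \<bullet>c (mat_adjoint A *\<^sub>v y)"
proof -
  note A' = mat_adjoint_carrier[OF A]
  have "(A *\<^sub>v x) \<bullet>c y = (\<Sum>i<nr. (\<Sum>j<nc. A $$ (i, j) * x $ j) * cnj (y $ i))"
    unfolding cscalar_prod_sum[OF y]
    by (intro sum.cong refl) (simp add: index_mult_mat_vec_sum[OF A x] del: index_mult_mat_vec)
  also have "\<dots> = (\<Sum>j<nc. \<Sum>i<nr. A $$ (i, j) * x $ j * cnj (y $ i))"
    unfolding sum_distrib_right by (rule sum.swap)
  also have "\<dots> = (\<Sum>j<nc. x $ j * cnj ((mat_adjoint A *\<^sub>v y) $ j))"
    by (intro sum.cong refl)
      (simp add: index_mult_mat_vec_sum[OF A' y] index_mat_adjoint[OF A] sum_distrib_left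
        mult_ac del: index_mult_mat_vec)
  also have "\<dots> = x \<bullet>c (mat_adjoint A *\<^sub>v y)"
    using A' y by (subst cscalar_prod_sum[of _ nc]) auto
  finally show ?thesis .
qed

lemma cscalar_prod_commute:
  fixes v w :: "complex vec"
  assumes "v \<in> carrier_vec n" "w \<in> carrier_vec n"
  shows "w \<bullet>c v = cnj (v \<bullet>c w)"
  unfolding cscalar_prod_sum[OF assms(1)] cscalar_prod_sum[OF assms(2)] by (simp add: mult.commute)

lemma cscalar_prod_smult_left:
  fixes v w :: "complex vec"
  assumes "v \<in> carrier_vec n" "w \<in> carrier_vec n"
  shows "(a \<cdot>\<^sub>v v) \<bullet>c w = a * (v \<bullet>c w)"
  using assms by (simp add: smult_scalar_prod_distrib[of _ n])

lemma cscalar_prod_add_left: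
  fixes u v w :: "complex vec"
  assumes "u \<in> carrier_vec n" "v \<in> carrier_vec n" "w \<in> carrier_vec n"
  shows "(u + v) \<bullet>c w = u \<bullet>c w + v \<bullet>c w"
  using assms by (simp add: add_scalar_prod_distrib[of _ n])

lemma cscalar_prod_self_sum:
  fixes v :: "complex vec"
  assumes "v \<in> carrier_vec n"
  shows "v \<bullet>c v = of_real (\<Sum>i<n. (cmod (v $ i))\<^sup>2)"
  by (simp add: cscalar_prod_sum[OF assms] complex_norm_square[symmetric])

lemma cscalar_prod_self_real:
  fixes v :: "complex vec"
  shows "v \<bullet>c v = of_real (Re (v \<bullet>c v))"
  by (simp add: cscalar_prod_self_sum[OF carrier_vec_dim_vec])

lemma cscalar_prod_self_nonneg:
  fixes v :: "complex vec"
  shows "Re (v \<bullet>c v) \<ge> 0"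
  by (simp add: cscalar_prod_self_sum[OF carrier_vec_dim_vec] sum_nonneg)

lemma cscalar_prod_self_pos:
  fixes v :: "complex vec"
  assumes "v \<in> carrier_vec n" "v \<noteq> 0\<^sub>v n"
  shows "Re (v \<bullet>c v) > 0"
proof -
  have "v \<bullet>c v \<noteq> 0" using assms by (simp del: conjugate_square_greater_0_vec)
  then have "Re (v \<bullet>c v) \<noteq> 0" by (metis cscalar_prod_self_real of_real_0)
  then show ?thesis using cscalar_prod_self_nonneg[of v] by linarith
qed

section \<open>Quadratic forms of complex matrices\<close>

lemma quadratic_form_bounded:
  fixes M :: "complex mat"
  assumes M: "M \<in> carrier_mat n n"
  obtains c where "c > 0"
    "\<And>x. x \<in> carrier_vec n \<Longrightarrow> cmod ((M *\<^sub>v x) \<bullet>c x) \<le> c * Re (x \<bullet>c x)"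
proof -
  define s where "s = (\<Sum>i<n. \<Sum>j<n. cmod (M $$ (i, j)))"
  have s0: "s \<ge> 0" unfolding s_def by (intro sum_nonneg) auto
  have bound: "cmod ((M *\<^sub>v x) \<bullet>c x) \<le> s * Re (x \<bullet>c x)" if x: "x \<in> carrier_vec n" for x
  proof -
    define N where "N = Re (x \<bullet>c x)"
    have N: "N = (\<Sum>i<n. (cmod (x $ i))\<^sup>2)"
      unfolding N_def cscalar_prod_self_sum[OF x] by simp
    have coord: "(cmod (x $ i))\<^sup>2 \<le> N" if "i < n" for i
      unfolding N using that by (intro member_le_sum) auto
    have prods: "cmod (x $ j) * cmod (x $ i) \<le> N" if "i < n" "j < n" for i j
      using coord[OF that(1)] coord[OF that(2)]
        sum_squares_bound[of "cmod (x $ j)" "cmod (x $ i)"] by linarith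
    have "(M *\<^sub>v x) \<bullet>c x = (\<Sum>i<n. \<Sum>j<n. M $$ (i, j) * (x $ j * cnj (x $ i)))"
      unfolding cscalar_prod_sum[OF x]
      by (intro sum.cong refl)
        (simp add: index_mult_mat_vec_sum[OF M x] sum_distrib_right mult.assoc
          del: index_mult_mat_vec)
    also have "cmod \<dots> \<le> (\<Sum>i<n. \<Sum>j<n. cmod (M $$ (i, j)) * N)"
    proof (intro order.trans[OF norm_sum] sum_mono)
      fix i j assume "i \<in> {..<n}" "j \<in> {..<n}"
      then show "cmod (M $$ (i, j) * (x $ j * cnj (x $ i))) \<le> cmod (M $$ (i, j)) * N"
        using prods[of i j] by (simp add: norm_mult mult_left_mono)
    qed
    finally show ?thesis by (simp add: s_def N_def sum_distrib_right)
  qed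
  show thesis
  proof
    \<comment> \<open>The sum \<open>s\<close> vanishes for \<open>M = 0\<close>, whereas a positive constant is wanted for division.\<close>
    show "s + 1 > 0" using s0 by simp
    fix x :: "complex vec" assume "x \<in> carrier_vec n"
    then show "cmod ((M *\<^sub>v x) \<bullet>c x) \<le> (s + 1) * Re (x \<bullet>c x)"
      using bound[of x] cscalar_prod_self_nonneg[of x] by (simp add: distrib_right)
  qed
qed

text \<open>
  Apply the bound for quadratic forms to the matrix \<open>M\<^sup>\<dagger> M\<close>, since \<open>\<langle>M x, M x\<rangle> = \<langle>M\<^sup>\<dagger> M x, x\<rangle>\<close>.
\<close>

lemma image_bounded:
  fixes M :: "complex mat"
  assumes M: "M \<in> carrier_mat n n"
  obtains c where "c > 0"
    "\<And>x. x \<in> carrier_vec n \<Longrightarrow> Re ((M *\<^sub>v x) \<bullet>c (M *\<^sub>v x)) \<le> c * Re (x \<bullet>c x)"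
proof -
  have M': "mat_adjoint M \<in> carrier_mat n n" using M by simp
  have MM: "mat_adjoint M * M \<in> carrier_mat n n" by (rule mult_carrier_mat[OF M' M])
  obtain c where c: "c > 0"
    "\<And>x. x \<in> carrier_vec n \<Longrightarrow> cmod (((mat_adjoint M * M) *\<^sub>v x) \<bullet>c x) \<le> c * Re (x \<bullet>c x)"
    using quadratic_form_bounded[OF MM] by metis
  show thesis
  proof (rule that[OF c(1)])
    fix x :: "complex vec" assume x: "x \<in> carrier_vec n"
    have Mx: "M *\<^sub>v x \<in> carrier_vec n" using M x by simp
    have "(M *\<^sub>v x) \<bullet>c (M *\<^sub>v x) = x \<bullet>c ((mat_adjoint M * M) *\<^sub>v x)"
      unfolding cscalar_prod_adjoint[OF M x Mx] assoc_mult_mat_vec[OF M' M x] ..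
    also have "\<dots> = cnj (((mat_adjoint M * M) *\<^sub>v x) \<bullet>c x)"
      using MM x by (intro cscalar_prod_commute[of _ n]) auto
    finally have "Re ((M *\<^sub>v x) \<bullet>c (M *\<^sub>v x)) \<le> cmod (((mat_adjoint M * M) *\<^sub>v x) \<bullet>c x)"
      by (simp add: complex_Re_le_cmod)
    also have "\<dots> \<le> c * Re (x \<bullet>c x)" by (rule c(2)[OF x])
    finally show "Re ((M *\<^sub>v x) \<bullet>c (M *\<^sub>v x)) \<le> c * Re (x \<bullet>c x)" .
  qed
qed

text \<open>
  Let \<open>c\<close> bound the quadratic form of \<open>G\<close>. Nonnegativity of the form at \<open>x + t G x\<close>, expanded by
  symmetry of \<open>G\<close>, reads \<open>0 \<le> \<langle>G x, x\<rangle> + 2 t \<langle>G x, G x\<rangle> + t\<^sup>2 \<langle>G G x, G x\<rangle>\<close> for real \<open>t\<close>;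
  the last product is at most \<open>c \<langle>G x, G x\<rangle>\<close>, so \<open>t = - 1 / c\<close> minimizes the resulting bound and
  gives the claim.
\<close>

lemma positive_semidefinite_image_bound:
  fixes G :: "complex mat"
  assumes G: "G \<in> carrier_mat n n" and sa: "mat_adjoint G = G"
    and psd: "\<And>x. x \<in> carrier_vec n \<Longrightarrow> Re ((G *\<^sub>v x) \<bullet>c x) \<ge> 0"
  obtains c where "c > 0"
    "\<And>x. x \<in> carrier_vec n \<Longrightarrow> Re ((G *\<^sub>v x) \<bullet>c (G *\<^sub>v x)) \<le> c * Re ((G *\<^sub>v x) \<bullet>c x)"
proof -
  obtain c where c: "c > 0"
    "\<And>x. x \<in> carrier_vec n \<Longrightarrow> cmod ((G *\<^sub>v x) \<bullet>c x) \<le> c * Re (x \<bullet>c x)"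
    using quadratic_form_bounded[OF G] by metis
  show thesis
  proof (rule that[OF c(1)])
    fix x :: "complex vec" assume x: "x \<in> carrier_vec n"
    define y where "y = G *\<^sub>v x"
    define t where "t = complex_of_real (- 1 / c)"
    have y: "y \<in> carrier_vec n" and Gy: "G *\<^sub>v y \<in> carrier_vec n"
      unfolding y_def using G x by auto
    have u: "x + t \<cdot>\<^sub>v y \<in> carrier_vec n" using x y by simp
    have Gu: "G *\<^sub>v (x + t \<cdot>\<^sub>v y) = y + t \<cdot>\<^sub>v (G *\<^sub>v y)"
      unfolding y_def using G x
      by (simp add: mult_add_distrib_mat_vec[of _ n n] mult_mat_vec[of _ n n])
    have Gu_closed: "y + t \<cdot>\<^sub>v (G *\<^sub>v y) \<in> carrier_vec n" using y Gy by simp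
    have sym: "(G *\<^sub>v y) \<bullet>c x = y \<bullet>c y"
      using cscalar_prod_adjoint[OF G y x] by (simp add: sa y_def)
    have right: "v \<bullet>c (x + t \<cdot>\<^sub>v y) = v \<bullet>c x + t * (v \<bullet>c y)" if v: "v \<in> carrier_vec n" for v
      using v x y
      by (simp add: conjugate_add_vec[of _ n] conjugate_smult_vec t_def
          scalar_prod_add_distrib[of _ n] scalar_prod_smult_distrib[of _ n])
    have "(G *\<^sub>v (x + t \<cdot>\<^sub>v y)) \<bullet>c (x + t \<cdot>\<^sub>v y)
      = y \<bullet>c x + 2 * t * (y \<bullet>c y) + t\<^sup>2 * ((G *\<^sub>v y) \<bullet>c y)"
      unfolding Gu right[OF Gu_closed]
      using x y Gy sym
      by (simp add: cscalar_prod_add_left[of _ n] cscalar_prod_smult_left[of _ n]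
          algebra_simps power2_eq_square)
    then have "0 \<le> Re (y \<bullet>c x + 2 * t * (y \<bullet>c y) + t\<^sup>2 * ((G *\<^sub>v y) \<bullet>c y))"
      using psd[OF u] by simp
    also have "\<dots> = Re (y \<bullet>c x) - 2 / c * Re (y \<bullet>c y) + (1 / c)\<^sup>2 * Re ((G *\<^sub>v y) \<bullet>c y)"
      by (simp add: t_def power2_eq_square)
    also have "\<dots> \<le> Re (y \<bullet>c x) - 2 / c * Re (y \<bullet>c y) + (1 / c)\<^sup>2 * (c * Re (y \<bullet>c y))"
      using c(2)[OF y] complex_Re_le_cmod[of "(G *\<^sub>v y) \<bullet>c y"]
      by (intro add_left_mono mult_left_mono) auto
    also have "\<dots> = Re (y \<bullet>c x) - Re (y \<bullet>c y) / c"
      using c(1) by (simp add: power2_eq_square field_simps)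
    finally show "Re ((G *\<^sub>v x) \<bullet>c (G *\<^sub>v x)) \<le> c * Re ((G *\<^sub>v x) \<bullet>c x)"
      using c(1) by (simp add: y_def field_simps)
  qed
qed

section \<open>Extreme eigenvalues as bounds for Rayleigh quotients\<close>

text \<open>
  The number \<open>m\<close> is the supremum of the set \<open>S\<close> of lower bounds for the Rayleigh quotient. It
  belongs to \<open>S\<close>, so \<open>H - m I\<close> is positive semidefinite; its maximality makes \<open>H - m I\<close>
  singular.
\<close>

lemma lowest_eigenvalue:
  fixes H :: "complex mat"
  assumes H: "H \<in> carrier_mat n n" and n: "n > 0" and sa: "mat_adjoint H = H"
  obtains m :: real where "eigenvalue H (of_real m)"
    "\<And>x. x \<in> carrier_vec n \<Longrightarrow> m * Re (x \<bullet>c x) \<le> Re ((H *\<^sub>v x) \<bullet>c x)"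
    "\<And>x. x \<in> carrier_vec n \<Longrightarrow> Re ((H *\<^sub>v x) \<bullet>c x) = m * Re (x \<bullet>c x)
       \<Longrightarrow> H *\<^sub>v x = of_real m \<cdot>\<^sub>v x"
proof -
  define S where
    "S = {m. \<forall>x\<in>carrier_vec n. m * Re (x \<bullet>c x) \<le> Re ((H *\<^sub>v x) \<bullet>c x)}"
  define m where "m = Sup S"
  obtain c where c: "\<And>x. x \<in> carrier_vec n \<Longrightarrow> cmod ((H *\<^sub>v x) \<bullet>c x) \<le> c * Re (x \<bullet>c x)"
    using quadratic_form_bounded[OF H] by metis
  have "- c \<in> S"
    unfolding S_def
  proof (intro CollectI ballI)
    fix x :: "complex vec" assume "x \<in> carrier_vec n"
    then show "- c * Re (x \<bullet>c x) \<le> Re ((H *\<^sub>v x) \<bullet>c x)"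
      using c[of x] abs_Re_le_cmod[of "(H *\<^sub>v x) \<bullet>c x"] by simp
  qed
  then have S_nonempty: "S \<noteq> {}" by auto
  have quotient: "k \<le> Re ((H *\<^sub>v x) \<bullet>c x) / Re (x \<bullet>c x)"
    if "k \<in> S" "x \<in> carrier_vec n" "x \<noteq> 0\<^sub>v n" for k x
    using that cscalar_prod_self_pos[of x n] unfolding S_def by (simp add: pos_le_divide_eq)
  have "unit_vec n 0 \<noteq> (0\<^sub>v n :: complex vec)" using n unit_vec_nonzero by blast
  then have S_bdd: "bdd_above S"
    using quotient[OF _ unit_vec_carrier] by (intro bdd_aboveI)
  have m_S: "m * Re (x \<bullet>c x) \<le> Re ((H *\<^sub>v x) \<bullet>c x)" if x: "x \<in> carrier_vec n" for x
  proof (cases "x = 0\<^sub>v n")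
    case False
    then have "m \<le> Re ((H *\<^sub>v x) \<bullet>c x) / Re (x \<bullet>c x)"
      unfolding m_def using x S_nonempty by (intro cSup_least quotient) auto
    then show ?thesis using cscalar_prod_self_pos[OF x False] by (simp add: pos_le_divide_eq)
  qed (use H in simp)

  define G where "G = char_matrix H (of_real m)"
  have G: "G \<in> carrier_mat n n" unfolding G_def using H by simp
  have saG: "mat_adjoint G = G"
  proof (rule eq_matI)
    fix i j assume "i < dim_row G" "j < dim_col G"
    then have ij: "i < n" "j < n" using G by auto
    have "cnj (H $$ (j, i)) = H $$ (i, j)"
      using index_mat_adjoint[OF H ij] by (simp add: sa)
    then show "mat_adjoint G $$ (i, j) = G $$ (i, j)"
      using H ij unfolding index_mat_adjoint[OF G ij] by (simp add: G_def char_matrix_def)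
  qed (use G in auto)
  have Gx: "G *\<^sub>v x = H *\<^sub>v x + (- of_real m) \<cdot>\<^sub>v x" if x: "x \<in> carrier_vec n" for x
    unfolding G_def char_matrix_def using H x
    by (simp add: add_mult_distrib_mat_vec[of _ n n] smult_mat_mult_mat_vec[of _ n n])
  have form_G: "Re ((G *\<^sub>v x) \<bullet>c x) = Re ((H *\<^sub>v x) \<bullet>c x) - m * Re (x \<bullet>c x)"
    if x: "x \<in> carrier_vec n" for x
    using H x cscalar_prod_self_real[of x]
    by (simp add: Gx cscalar_prod_add_left[of _ n] cscalar_prod_smult_left[of _ n])
  have psd: "Re ((G *\<^sub>v x) \<bullet>c x) \<ge> 0" if "x \<in> carrier_vec n" for x
    using m_S[OF that] form_G[OF that] by simp
  obtain d where d: "d > 0"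
    "\<And>x. x \<in> carrier_vec n \<Longrightarrow> Re ((G *\<^sub>v x) \<bullet>c (G *\<^sub>v x)) \<le> d * Re ((G *\<^sub>v x) \<bullet>c x)"
    using positive_semidefinite_image_bound[OF G saG psd] by metis

  have "det G = 0"
  proof (rule ccontr)
    assume "det G \<noteq> 0"
    then obtain K where K: "K \<in> carrier_mat n n" and KG: "K * G = 1\<^sub>m n"
      using det_non_zero_imp_unit[OF G, unfolded Units_def, of "()"]
      by (auto simp: ring_mat_def)
    obtain k where k: "k > 0"
      "\<And>x. x \<in> carrier_vec n \<Longrightarrow> Re ((K *\<^sub>v x) \<bullet>c (K *\<^sub>v x)) \<le> k * Re (x \<bullet>c x)"
      using image_bounded[OF K] by metis
    have "m + 1 / (k * d) \<in> S" unfolding S_def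
    proof (intro CollectI ballI)
      fix x :: "complex vec" assume x: "x \<in> carrier_vec n"
      have y: "G *\<^sub>v x \<in> carrier_vec n" using G x by simp
      have "K *\<^sub>v (G *\<^sub>v x) = x"
        using assoc_mult_mat_vec[OF K G x] KG x by simp
      then have "Re (x \<bullet>c x) \<le> k * Re ((G *\<^sub>v x) \<bullet>c (G *\<^sub>v x))" using k(2)[OF y] by simp
      also have "\<dots> \<le> k * (d * Re ((G *\<^sub>v x) \<bullet>c x))"
        using d(2)[OF x] k(1) by (intro mult_left_mono) auto
      finally have "1 / (k * d) * Re (x \<bullet>c x) \<le> Re ((G *\<^sub>v x) \<bullet>c x)"
        using k(1) d(1) by (simp add: field_simps)
      then show "(m + 1 / (k * d)) * Re (x \<bullet>c x) \<le> Re ((H *\<^sub>v x) \<bullet>c x)"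
        unfolding form_G[OF x] by (simp add: distrib_right)
    qed
    then have "m + 1 / (k * d) \<le> m" unfolding m_def using S_bdd by (rule cSup_upper)
    then show False using k(1) d(1) by (simp add: field_simps)
  qed
  then have "eigenvalue H (of_real m)" unfolding eigenvalue_det[OF H] G_def .
  moreover have "H *\<^sub>v x = of_real m \<cdot>\<^sub>v x"
    if x: "x \<in> carrier_vec n" and eq: "Re ((H *\<^sub>v x) \<bullet>c x) = m * Re (x \<bullet>c x)" for x
  proof -
    have y: "G *\<^sub>v x \<in> carrier_vec n" using G x by simp
    have "Re ((G *\<^sub>v x) \<bullet>c (G *\<^sub>v x)) \<le> 0" using d(2)[OF x] form_G[OF x] eq by simp
    then have zero: "G *\<^sub>v x = 0\<^sub>v n" using cscalar_prod_self_pos[OF y] by force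
    show ?thesis
    proof (rule eq_vecI)
      fix i assume "i < dim_vec (of_real m \<cdot>\<^sub>v x)"
      then have i: "i < n" using x by simp
      have "(H *\<^sub>v x + (- of_real m) \<cdot>\<^sub>v x) $ i = 0" using zero Gx[OF x] i by simp
      then show "(H *\<^sub>v x) $ i = (of_real m \<cdot>\<^sub>v x) $ i"
        using H x i by simp
    qed (use H x in auto)
  qed
  ultimately show thesis using m_S that by blast
qed

text \<open>
  A scalar \<open>c\<close> that makes \<open>c M\<close> Hermitian selects one end of the spectrum of \<open>M\<close>: the values
  \<open>1\<close> and \<open>- 1\<close> select the two ends for a Hermitian matrix, \<open>- \<i>\<close> and \<open>\<i>\<close> those for a
  skew-Hermitian one. The number \<open>w\<close> is the Rayleigh quotient of \<open>M\<close> at \<open>x\<close>.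
\<close>

lemma rayleigh_quotient_extreme_eigenvalue:
  fixes M :: "complex mat"
  assumes M: "M \<in> carrier_mat n n" and c: "c \<noteq> 0" and sa: "mat_adjoint (c \<cdot>\<^sub>m M) = c \<cdot>\<^sub>m M"
    and x: "x \<in> carrier_vec n" "x \<noteq> 0\<^sub>v n" and w: "(M *\<^sub>v x) \<bullet>c x = w * (x \<bullet>c x)"
  obtains k where "k \<in> spectrum M" "Re (c * k) \<le> Re (c * w)"
    "Re (c * k) = Re (c * w) \<Longrightarrow> M *\<^sub>v x = k \<cdot>\<^sub>v x"
proof -
  have n: "n > 0" using x by (cases n) auto
  have cM: "c \<cdot>\<^sub>m M \<in> carrier_mat n n" using M by simp
  have cMv: "(c \<cdot>\<^sub>m M) *\<^sub>v v = c \<cdot>\<^sub>v (M *\<^sub>v v)" if "v \<in> carrier_vec n" for v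
    using M that by (rule smult_mat_mult_mat_vec)
  have divide: "M *\<^sub>v v = (a / c) \<cdot>\<^sub>v v"
    if v: "v \<in> carrier_vec n" and eq: "(c \<cdot>\<^sub>m M) *\<^sub>v v = a \<cdot>\<^sub>v v" for v a
  proof -
    have "M *\<^sub>v v = (1 / c) \<cdot>\<^sub>v (c \<cdot>\<^sub>v (M *\<^sub>v v))" using c by (simp add: smult_smult_assoc)
    also have "\<dots> = (a / c) \<cdot>\<^sub>v v" unfolding cMv[OF v, symmetric] eq by (simp add: smult_smult_assoc)
    finally show ?thesis .
  qed
  obtain m :: real where m: "eigenvalue (c \<cdot>\<^sub>m M) (of_real m)"
    "m * Re (x \<bullet>c x) \<le> Re (((c \<cdot>\<^sub>m M) *\<^sub>v x) \<bullet>c x)"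
    "Re (((c \<cdot>\<^sub>m M) *\<^sub>v x) \<bullet>c x) = m * Re (x \<bullet>c x) \<Longrightarrow> (c \<cdot>\<^sub>m M) *\<^sub>v x = of_real m \<cdot>\<^sub>v x"
    using lowest_eigenvalue[OF cM n sa] x(1) by metis
  have pos: "Re (x \<bullet>c x) > 0" using x by (rule cscalar_prod_self_pos)
  have "((c \<cdot>\<^sub>m M) *\<^sub>v x) \<bullet>c x = c * w * (x \<bullet>c x)"
    using M x w by (simp add: cMv cscalar_prod_smult_left[of _ n])
  also have "\<dots> = c * w * of_real (Re (x \<bullet>c x))" using cscalar_prod_self_real[of x] by metis
  finally have form: "Re (((c \<cdot>\<^sub>m M) *\<^sub>v x) \<bullet>c x) = Re (c * w) * Re (x \<bullet>c x)" by simp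
  show thesis
  proof
    obtain v where "v \<in> carrier_vec n" "v \<noteq> 0\<^sub>v n" "(c \<cdot>\<^sub>m M) *\<^sub>v v = of_real m \<cdot>\<^sub>v v"
      using m(1) cM unfolding eigenvalue_def eigenvector_def by auto
    then show "of_real m / c \<in> spectrum M"
      using M divide unfolding spectrum_def eigenvalue_def eigenvector_def by auto
    show "Re (c * (of_real m / c)) \<le> Re (c * w)"
      using m(2) pos c unfolding form by simp
    assume "Re (c * (of_real m / c)) = Re (c * w)"
    then have "Re (c * w) = m" using c by simp
    then show "M *\<^sub>v x = (of_real m / c) \<cdot>\<^sub>v x"
      using form m(3) divide[OF x(1)] by simp
  qed
qed

section \<open>Hermitian and skew-Hermitian parts\<close>

lemma hermitian_part_carrier [simp]:
  "A \<in> carrier_mat n n \<Longrightarrow> hermitian_part A \<in> carrier_mat n n"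
  unfolding hermitian_part_def by simp

lemma skew_hermitian_part_carrier [simp]:
  "A \<in> carrier_mat n n \<Longrightarrow> skew_hermitian_part A \<in> carrier_mat n n"
  unfolding skew_hermitian_part_def by (simp add: minus_carrier_mat)

lemma adjoint_smult_hermitian_part:
  assumes A: "A \<in> carrier_mat n n" and c: "cnj c = c"
  shows "mat_adjoint (c \<cdot>\<^sub>m hermitian_part A) = c \<cdot>\<^sub>m hermitian_part A"
proof -
  let ?M = "c \<cdot>\<^sub>m hermitian_part A"
  have M: "?M \<in> carrier_mat n n" using A by simp
  show ?thesis
  proof (rule eq_matI)
    fix i j assume "i < dim_row ?M" "j < dim_col ?M"
    then have ij: "i < n" "j < n" using M by auto
    show "mat_adjoint ?M $$ (i, j) = ?M $$ (i, j)"
      using A ij mat_adjoint_carrier[OF A] c unfolding index_mat_adjoint[OF M ij]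
      by (simp add: hermitian_part_def index_mat_adjoint[OF A] algebra_simps)
  qed (use hermitian_part_carrier[OF A] in auto)
qed

lemma adjoint_smult_skew_hermitian_part:
  assumes A: "A \<in> carrier_mat n n" and c: "cnj c = - c"
  shows "mat_adjoint (c \<cdot>\<^sub>m skew_hermitian_part A) = c \<cdot>\<^sub>m skew_hermitian_part A"
proof -
  let ?M = "c \<cdot>\<^sub>m skew_hermitian_part A"
  have M: "?M \<in> carrier_mat n n" using A by simp
  show ?thesis
  proof (rule eq_matI)
    fix i j assume "i < dim_row ?M" "j < dim_col ?M"
    then have ij: "i < n" "j < n" using M by auto
    show "mat_adjoint ?M $$ (i, j) = ?M $$ (i, j)"
      using A ij mat_adjoint_carrier[OF A] c unfolding index_mat_adjoint[OF M ij]
      by (simp add: skew_hermitian_part_def index_mat_adjoint[OF A] algebra_simps)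
  qed (use skew_hermitian_part_carrier[OF A] in auto)
qed

lemma hermitian_part_mult_vec:
  assumes "A \<in> carrier_mat n n" "x \<in> carrier_vec n"
  shows "hermitian_part A *\<^sub>v x = (1 / 2) \<cdot>\<^sub>v (A *\<^sub>v x + mat_adjoint A *\<^sub>v x)"
  using assms mat_adjoint_carrier[OF assms(1)] unfolding hermitian_part_def
  by (simp add: smult_mat_mult_mat_vec[of _ n n] add_mult_distrib_mat_vec[of _ n n])

lemma skew_hermitian_part_mult_vec:
  assumes "A \<in> carrier_mat n n" "x \<in> carrier_vec n"
  shows "skew_hermitian_part A *\<^sub>v x = (1 / 2) \<cdot>\<^sub>v (A *\<^sub>v x - mat_adjoint A *\<^sub>v x)"
  using assms mat_adjoint_carrier[OF assms(1)] unfolding skew_hermitian_part_def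
  by (simp add: smult_mat_mult_mat_vec[of _ n n] minus_mult_distrib_mat_vec[of _ n n]
      minus_carrier_mat)

lemma rayleigh_quotient_parts:
  fixes A :: "complex mat"
  assumes A: "A \<in> carrier_mat n n" and x: "x \<in> carrier_vec n"
    and z: "(A *\<^sub>v x) \<bullet>c x = z * (x \<bullet>c x)"
  shows "(hermitian_part A *\<^sub>v x) \<bullet>c x = of_real (Re z) * (x \<bullet>c x)"
    and "(skew_hermitian_part A *\<^sub>v x) \<bullet>c x = (\<i> * of_real (Im z)) * (x \<bullet>c x)"
proof -
  have A': "mat_adjoint A \<in> carrier_mat n n" using A by simp
  have Ax: "A *\<^sub>v x \<in> carrier_vec n" "mat_adjoint A *\<^sub>v x \<in> carrier_vec n"
    using mult_mat_vec_carrier[OF A x] mult_mat_vec_carrier[OF A' x] by auto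
  have "(mat_adjoint A *\<^sub>v x) \<bullet>c x = cnj ((A *\<^sub>v x) \<bullet>c x)"
    unfolding cscalar_prod_adjoint[OF A x x] by (rule cscalar_prod_commute[OF x Ax(2)])
  also have "\<dots> = cnj z * (x \<bullet>c x)"
    unfolding z using cscalar_prod_self_real[of x] by (metis complex_cnj_complex_of_real complex_cnj_mult)
  finally have z': "(mat_adjoint A *\<^sub>v x) \<bullet>c x = cnj z * (x \<bullet>c x)" .
  have "(hermitian_part A *\<^sub>v x) \<bullet>c x = (z + cnj z) / 2 * (x \<bullet>c x)"
    unfolding hermitian_part_mult_vec[OF A x] using Ax x
    by (simp add: cscalar_prod_smult_left[of _ n] cscalar_prod_add_left[of _ n] z z' field_simps)
  then show "(hermitian_part A *\<^sub>v x) \<bullet>c x = of_real (Re z) * (x \<bullet>c x)"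
    by (simp add: complex_add_cnj)
  have "(skew_hermitian_part A *\<^sub>v x) \<bullet>c x = (z - cnj z) / 2 * (x \<bullet>c x)"
    unfolding skew_hermitian_part_mult_vec[OF A x] using Ax x
    by (simp add: cscalar_prod_smult_left[of _ n] minus_scalar_prod_distrib[of _ n] z z'
        field_simps)
  then show "(skew_hermitian_part A *\<^sub>v x) \<bullet>c x = (\<i> * of_real (Im z)) * (x \<bullet>c x)"
    by (simp add: complex_diff_cnj mult.commute)
qed

lemma mult_vec_parts:
  assumes A: "A \<in> carrier_mat n n" and x: "x \<in> carrier_vec n"
  shows "A *\<^sub>v x = hermitian_part A *\<^sub>v x + skew_hermitian_part A *\<^sub>v x"
  unfolding hermitian_part_mult_vec[OF A x] skew_hermitian_part_mult_vec[OF A x]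
  using A x mat_adjoint_carrier[OF A] by (intro eq_vecI) (auto simp: field_simps)

section \<open>Fremdervalues\<close>

text \<open>
  A fremdervalue is a Rayleigh quotient of \<open>A\<close> at a vector that is not an eigenvector for it:
  orthogonality to \<open>(z I - A) x\<close> gives the first, \<open>x \<notin> ker (z I - A)\<close> the second.
\<close>

lemma fremdervalue_rayleigh_quotient:
  assumes A: "A \<in> carrier_mat n n" and z: "fremdervalue A z"
  obtains x where "x \<in> carrier_vec n" "x \<noteq> 0\<^sub>v n" "(A *\<^sub>v x) \<bullet>c x = z * (x \<bullet>c x)"
    "A *\<^sub>v x \<noteq> z \<cdot>\<^sub>v x"
proof -
  define M where "M = z \<cdot>\<^sub>m 1\<^sub>m n - A"
  have M: "M \<in> carrier_mat n n" unfolding M_def using A by (rule minus_carrier_mat)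
  obtain x where x: "x \<in> carrier_vec n" and orth: "x \<bullet>c (M *\<^sub>v x) = 0" and ker: "x \<notin> mat_kernel M"
    using z A M unfolding fremdervalue_def nontrivial_fremdervector_def fremdervector_def M_def
    by auto
  have Ax: "A *\<^sub>v x \<in> carrier_vec n" using A x by simp
  have Mx: "M *\<^sub>v x = z \<cdot>\<^sub>v x - A *\<^sub>v x"
    unfolding M_def using A x
    by (simp add: minus_mult_distrib_mat_vec[of _ n n] smult_mat_mult_mat_vec[of _ n n])
  have "(M *\<^sub>v x) \<bullet>c x = 0"
    using cscalar_prod_commute[of x n "M *\<^sub>v x"] M x orth by simp
  then have "(A *\<^sub>v x) \<bullet>c x = z * (x \<bullet>c x)"
    unfolding Mx using Ax x
    by (simp add: minus_scalar_prod_distrib[of _ n] cscalar_prod_smult_left[of _ n])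
  moreover have "A *\<^sub>v x \<noteq> z \<cdot>\<^sub>v x"
    using ker M x Mx unfolding mat_kernel[OF M] by auto
  moreover from this have "x \<noteq> 0\<^sub>v n" using A by auto
  ultimately show thesis using x that by blast
qed

theorem theorem4p6:
  fixes n :: nat and A B C :: "complex mat" and z :: complex
  assumes "n \<ge> 1"
    and "A \<in> carrier_mat n n"
    and "B = hermitian_part A"
    and "C = skew_hermitian_part A"
    and "fremdervalue A z"
  shows "(Min (re_spectrum B) \<le> Re z \<and> Re z \<le> Max (re_spectrum B)) \<and>
         (Min (im_spectrum C) \<le> Im z \<and> Im z \<le> Max (im_spectrum C)) \<and>
         \<not> (Re z \<in> {Min (re_spectrum B), Max (re_spectrum B)} \<and>
            Im z \<in> {Min (im_spectrum C), Max (im_spectrum C)})"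
proof -
  note A = assms(2)
  have B: "B \<in> carrier_mat n n" and C: "C \<in> carrier_mat n n" using A assms(3,4) by auto
  obtain x where x: "x \<in> carrier_vec n" "x \<noteq> 0\<^sub>v n"
    and zx: "(A *\<^sub>v x) \<bullet>c x = z * (x \<bullet>c x)" and not_eigen: "A *\<^sub>v x \<noteq> z \<cdot>\<^sub>v x"
    using fremdervalue_rayleigh_quotient[OF A assms(5)] by metis
  have Bx: "(B *\<^sub>v x) \<bullet>c x = of_real (Re z) * (x \<bullet>c x)"
    and Cx: "(C *\<^sub>v x) \<bullet>c x = (\<i> * of_real (Im z)) * (x \<bullet>c x)"
    using rayleigh_quotient_parts[OF A x(1) zx] assms(3,4) by auto
  have sa: "mat_adjoint (1 \<cdot>\<^sub>m B) = 1 \<cdot>\<^sub>m B" "mat_adjoint ((- 1) \<cdot>\<^sub>m B) = (- 1) \<cdot>\<^sub>m B"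
    "mat_adjoint ((- \<i>) \<cdot>\<^sub>m C) = (- \<i>) \<cdot>\<^sub>m C" "mat_adjoint (\<i> \<cdot>\<^sub>m C) = \<i> \<cdot>\<^sub>m C"
    unfolding assms(3,4)
    by (intro adjoint_smult_hermitian_part[OF A] adjoint_smult_skew_hermitian_part[OF A], simp)+
  obtain a where a: "a \<in> spectrum B" "Re a \<le> Re z" "Re a = Re z \<Longrightarrow> B *\<^sub>v x = a \<cdot>\<^sub>v x"
    using rayleigh_quotient_extreme_eigenvalue[OF B _ sa(1) x Bx] by auto
  obtain b where b: "b \<in> spectrum B" "Re z \<le> Re b" "Re b = Re z \<Longrightarrow> B *\<^sub>v x = b \<cdot>\<^sub>v x"
    using rayleigh_quotient_extreme_eigenvalue[OF B _ sa(2) x Bx] by auto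
  obtain c where c: "c \<in> spectrum C" "Im c \<le> Im z" "Im c = Im z \<Longrightarrow> C *\<^sub>v x = c \<cdot>\<^sub>v x"
    using rayleigh_quotient_extreme_eigenvalue[OF C _ sa(3) x Cx] by auto
  obtain d where d: "d \<in> spectrum C" "Im z \<le> Im d" "Im d = Im z \<Longrightarrow> C *\<^sub>v x = d \<cdot>\<^sub>v x"
    using rayleigh_quotient_extreme_eigenvalue[OF C _ sa(4) x Cx] by auto
  have fin: "finite (re_spectrum B)" "finite (im_spectrum C)"
    unfolding re_spectrum_def im_spectrum_def
    using card_finite_spectrum(1)[OF B] card_finite_spectrum(1)[OF C] by auto
  have Min_Max: "Min (re_spectrum B) \<le> Re a" "Re b \<le> Max (re_spectrum B)"
    "Min (im_spectrum C) \<le> Im c" "Im d \<le> Max (im_spectrum C)"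
    using a(1) b(1) c(1) d(1) fin by (auto simp: re_spectrum_def im_spectrum_def)
  have False if "Re z \<in> {Min (re_spectrum B), Max (re_spectrum B)}"
    "Im z \<in> {Min (im_spectrum C), Max (im_spectrum C)}"
  proof -
    have "Re a = Re z \<or> Re b = Re z" using that(1) a(2) b(2) Min_Max by auto
    then obtain k where k: "B *\<^sub>v x = k \<cdot>\<^sub>v x" using a(3) b(3) by blast
    have "Im c = Im z \<or> Im d = Im z" using that(2) c(2) d(2) Min_Max by auto
    then obtain l where l: "C *\<^sub>v x = l \<cdot>\<^sub>v x" using c(3) d(3) by blast
    have Ax: "A *\<^sub>v x = (k + l) \<cdot>\<^sub>v x"
      using mult_vec_parts[OF A x(1)] k l by (simp add: assms(3,4) add_smult_distrib_vec)
    then have "(k + l) * (x \<bullet>c x) = z * (x \<bullet>c x)"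
      using zx cscalar_prod_smult_left[OF x(1) x(1)] by simp
    moreover have "x \<bullet>c x \<noteq> 0" using cscalar_prod_self_pos[OF x] by auto
    ultimately have "k + l = z" by simp
    then show False using Ax not_eigen by simp
  qed
  then show ?thesis using a(2) b(2) c(2) d(2) Min_Max by auto
qed

end
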